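(* In the setting of the context, let $\xi'_{xy}\in\mathbb{R}$ ($x\in\mathcal{X}_a$, $y\in\mathcal{Y}_x$) be fixed and let $\eta>0$. Consider the ADMM iteration, defined in the context, for the problem $$\min_{\Pi^t\in\mathcal{F}_t,\ \Pi^s\in\mathcal{F}_s,\ \Pi\in\mathbb{R}^{\mathcal{E}}}\ -\sum_{x\in\mathcal{X}_o}\sum_{y\in\mathcal{Y}_x}\delta_{xy}\pi^t_{xy}-\sum_{y\in\mathcal{Y}}\sum_{x\in\mathcal{X}_y}\gamma_{xy}\pi^s_{xy}-\sum_{x\in\mathcal{X}_a}\sum_{y\in\mathcal{Y}_x}(\delta_{xy}+\xi'_{xy})\pi^t_{xy}$$ subject to $\pi^t_{xy}=\pi_{xy}$ and $\pi_{xy}=\pi^s_{xy}$ for all $\{x,y\}\in\mathcal{E}$. One such ADMM iteration is equivalent to the following collection of separate steps: (1) for each $x\in\mathcal{X}_o$, $$\Pi^t_x(k+1)\in\arg\min_{\Pi^t_x\in\mathcal{F}^t_x}\ -\sum_{y\in\mathcal{Y}_x}\delta_{xy}\pi^t_{xy}+\sum_{y\in\mathcal{Y}_x}\alpha^t_{xy}(k)\pi^t_{xy}+\frac{\eta}{2}\sum_{y\in\mathcal{Y}_x}\bigl(\pi^t_{xy}-\pi_{xy}(k)\bigr)^2;$$ (2) for each $x\in\mathcal{X}_a$, $$\Pi^t_x(k+1)\in\arg\min_{\Pi^t_x\in\mathcal{F}^t_x}\ -\sum_{y\in\mathcal{Y}_x}(\delta_{xy}+\xi'_{xy})\pi^t_{xy}+\sum_{y\in\mathcal{Y}_x}\alpha^t_{xy}(k)\pi^t_{xy}+\frac{\eta}{2}\sum_{y\in\mathcal{Y}_x}\bigl(\pi^t_{xy}-\pi_{xy}(k)\bigr)^2;$$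 (3) for each $y\in\mathcal{Y}$, $$\Pi^s_y(k+1)\in\arg\min_{\Pi^s_y\in\mathcal{F}^s_y}\ -\sum_{x\in\mathcal{X}_y}\gamma_{xy}\pi^s_{xy}-\sum_{x\in\mathcal{X}_y}\alpha^s_{xy}(k)\pi^s_{xy}+\frac{\eta}{2}\sum_{x\in\mathcal{X}_y}\bigl(\pi_{xy}(k)-\pi^s_{xy}\bigr)^2;$$ (4) for each $\{x,y\}\in\mathcal{E}$, $$\pi_{xy}(k+1)\in\arg\min_{\pi_{xy}\in\mathbb{R}}\ -\alpha^t_{xy}(k)\pi_{xy}+\alpha^s_{xy}(k)\pi_{xy}+\frac{\eta}{2}\bigl(\pi^t_{xy}(k+1)-\pi_{xy}\bigr)^2+\frac{\eta}{2}\bigl(\pi_{xy}-\pi^s_{xy}(k+1)\bigr)^2;$$ (5) for each $\{x,y\}\in\mathcal{E}$, $\alpha^t_{xy}(k+1)=\alpha^t_{xy}(k)+\eta\bigl(\pi^t_{xy}(k+1)-\pi_{xy}(k+1)\bigr)$; (6) for each $\{x,y\}\in\mathcal{E}$, $\alpha^s_{xy}(k+1)=\alpha^s_{xy}(k)+\eta\bigl(\pi_{xy}(k+1)-\pi^s_{xy}(k+1)\bigr)$.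
   Context: $\mathcal{X}$ (targets) and $\mathcal{Y}$ (sources) are finite nonempty sets forming the two sides of a bipartite graph with edge set $\mathcal{E}\subseteq\mathcal{X}\times\mathcal{Y}$. For $y\in\mathcal{Y}$, $\mathcal{X}_y=\{x:\{x,y\}\in\mathcal{E}\}$ and for $x\in\mathcal{X}$, $\mathcal{Y}_x=\{y:\{x,y\}\in\mathcal{E}\}$; all these sets are nonempty. $\mathcal{X}_a\subseteq\mathcal{X}$ is the set of compromised targets and $\mathcal{X}_o=\mathcal{X}\setminus\mathcal{X}_a$. Parameters: $\delta_{xy},\gamma_{xy}\ge 0$ for $\{x,y\}\in\mathcal{E}$; $\bar p_x\ge\underline p_x\ge 0$; $\bar q_y\ge\underline q_y\ge 0$. Variables: $\Pi^t=\{\pi^t_{xy}\}$, $\Pi^s=\{\pi^s_{xy}\}$, $\Pi=\{\pi_{xy}\}$, all indexed by $\{x,y\}\in\mathcal{E}$; $\Pi^t_x=\{\pi^t_{xy}\}_{y\in\mathcal{Y}_x}$ is the block of target $x$ and $\Pi^s_y=\{\pi^s_{xy}\}_{x\in\mathcal{X}_y}$ the block of source $y$. Define $\mathcal{F}^t_x=\{\Pi^t_x:\ \pi^t_{xy}\ge 0\ \forall y\in\mathcal{Y}_x,\ \underline p_x\le\sum_{y\in\mathcal{Y}_x}\pi^t_{xy}\le\bar p_x\}$, $\mathcal{F}^s_y=\{\Pi^s_y:\ \pi^s_{xy}\ge 0\ \forall x\in\mathcal{X}_y,\ \underline q_y\le\sum_{x\in\mathcal{X}_y}\pi^s_{xy}\le\bar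 q_y\}$, $\mathcal{F}_t=\{\Pi^t:\Pi^t_x\in\mathcal{F}^t_x\ \forall x\in\mathcal{X}\}$, $\mathcal{F}_s=\{\Pi^s:\Pi^s_y\in\mathcal{F}^s_y\ \forall y\in\mathcal{Y}\}$. The augmented Lagrangian, with multipliers $\alpha^t=\{\alpha^t_{xy}\}$, $\alpha^s=\{\alpha^s_{xy}\}$ in $\mathbb{R}^{\mathcal{E}}$, is $$L(\Pi^t,\Pi^s,\Pi,\alpha^t,\alpha^s)=-\sum_{x\in\mathcal{X}_o}\sum_{y\in\mathcal{Y}_x}\delta_{xy}\pi^t_{xy}-\sum_{y\in\mathcal{Y}}\sum_{x\in\mathcal{X}_y}\gamma_{xy}\pi^s_{xy}-\sum_{x\in\mathcal{X}_a}\sum_{y\in\mathcal{Y}_x}(\delta_{xy}+\xi'_{xy})\pi^t_{xy}$$ $$+\sum_{\{x,y\}\in\mathcal{E}}\Bigl[\alpha^t_{xy}(\pi^t_{xy}-\pi_{xy})+\alpha^s_{xy}(\pi_{xy}-\pi^s_{xy})+\tfrac{\eta}{2}(\pi^t_{xy}-\pi_{xy})^2+\tfrac{\eta}{2}(\pi_{xy}-\pi^s_{xy})^2\Bigr].$$ One ADMM iteration (alternating direction method of multipliers) from $(\Pi(k),\alpha^t(k),\alpha^s(k))$ is: (i) $(\Pi^t(k+1),\Pi^s(k+1))\in\arg\min_{\Pi^t\in\mathcal{F}_t,\Pi^s\in\mathcal{F}_s}L(\Pi^t,\Pi^s,\Pi(k),\alpha^t(k),\alpha^s(k))$; (ii)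 $\Pi(k+1)\in\arg\min_{\Pi\in\mathbb{R}^{\mathcal{E}}}L(\Pi^t(k+1),\Pi^s(k+1),\Pi,\alpha^t(k),\alpha^s(k))$; (iii) each multiplier is increased by $\eta$ times the residual of its constraint at the new iterate, the residuals being $\pi^t_{xy}-\pi_{xy}$ for $\alpha^t_{xy}$ and $\pi_{xy}-\pi^s_{xy}$ for $\alpha^s_{xy}$. "Equivalent" means that $(\Pi^t(k+1),\Pi^s(k+1),\Pi(k+1),\alpha^t(k+1),\alpha^s(k+1))$ satisfies (i)-(iii) if and only if it satisfies (1)-(6). *)

theory Defs
  imports Complex_Main "HOL-Library.FuncSet"
begin

text \<open>
  The edge \<open>{x, y}\<close> is encoded as the pair \<open>(x, y)\<close>.  A family of reals indexed by a set \<open>I\<close>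
  is an element of \<open>I \<rightarrow>\<^sub>E UNIV\<close>, so that equality of families is equality on the index set;
  families of given parameters are total functions of which only the values on the
  index set are used.
\<close>

locale transport_network =
  fixes X :: "'a set" and Y :: "'b set" and E :: "('a \<times> 'b) set" and Xa :: "'a set"
    and \<delta> \<gamma> :: "'a \<times> 'b \<Rightarrow> real"
    and p_lo p_up :: "'a \<Rightarrow> real" and q_lo q_up :: "'b \<Rightarrow> real"
  assumes finite_X: "finite X" and X_nonempty: "X \<noteq> {}"
    and finite_Y: "finite Y" and Y_nonempty: "Y \<noteq> {}"
    and edges: "E \<subseteq> X \<times> Y"
    and targets_nonempty: "\<And>y. y \<in> Y \<Longrightarrow> {x. (x, y) \<in> E} \<noteq> {}"
    and sources_nonempty: "\<And>x. x \<in> X \<Longrightarrow> {y. (x, y) \<in> E} \<noteq> {}"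
    and compromised: "Xa \<subseteq> X"
    and delta_nonneg: "\<And>e. e \<in> E \<Longrightarrow> 0 \<le> \<delta> e"
    and gamma_nonneg: "\<And>e. e \<in> E \<Longrightarrow> 0 \<le> \<gamma> e"
    and p_bounds: "\<And>x. x \<in> X \<Longrightarrow> 0 \<le> p_lo x \<and> p_lo x \<le> p_up x"
    and q_bounds: "\<And>y. y \<in> Y \<Longrightarrow> 0 \<le> q_lo y \<and> q_lo y \<le> q_up y"

definition sources_of :: "('a \<times> 'b) set \<Rightarrow> 'a \<Rightarrow> 'b set" where
  "sources_of E x = {y. (x, y) \<in> E}"

definition targets_of :: "('a \<times> 'b) set \<Rightarrow> 'b \<Rightarrow> 'a set" where
  "targets_of E y = {x. (x, y) \<in> E}"

definition target_block :: "('a \<times> 'b) set \<Rightarrow> ('a \<times> 'b \<Rightarrow> real) \<Rightarrow> 'a \<Rightarrow> 'b \<Rightarrow> real" where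
  "target_block E P x = (\<lambda>y\<in>sources_of E x. P (x, y))"

definition source_block :: "('a \<times> 'b) set \<Rightarrow> ('a \<times> 'b \<Rightarrow> real) \<Rightarrow> 'b \<Rightarrow> 'a \<Rightarrow> real" where
  "source_block E P y = (\<lambda>x\<in>targets_of E y. P (x, y))"

definition feasible_target_block ::
  "('a \<times> 'b) set \<Rightarrow> ('a \<Rightarrow> real) \<Rightarrow> ('a \<Rightarrow> real) \<Rightarrow> 'a \<Rightarrow> ('b \<Rightarrow> real) set" where
  "feasible_target_block E p_lo p_up x =
    {u \<in> sources_of E x \<rightarrow>\<^sub>E UNIV. (\<forall>y\<in>sources_of E x. 0 \<le> u y) \<and>
       p_lo x \<le> (\<Sum>y\<in>sources_of E x. u y) \<and> (\<Sum>y\<in>sources_of E x. u y) \<le> p_up x}"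

definition feasible_source_block ::
  "('a \<times> 'b) set \<Rightarrow> ('b \<Rightarrow> real) \<Rightarrow> ('b \<Rightarrow> real) \<Rightarrow> 'b \<Rightarrow> ('a \<Rightarrow> real) set" where
  "feasible_source_block E q_lo q_up y =
    {v \<in> targets_of E y \<rightarrow>\<^sub>E UNIV. (\<forall>x\<in>targets_of E y. 0 \<le> v x) \<and>
       q_lo y \<le> (\<Sum>x\<in>targets_of E y. v x) \<and> (\<Sum>x\<in>targets_of E y. v x) \<le> q_up y}"

definition feasible_targets ::
  "'a set \<Rightarrow> ('a \<times> 'b) set \<Rightarrow> ('a \<Rightarrow> real) \<Rightarrow> ('a \<Rightarrow> real) \<Rightarrow> ('a \<times> 'b \<Rightarrow> real) set" where
  "feasible_targets X E p_lo p_up =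
    {P \<in> E \<rightarrow>\<^sub>E UNIV. \<forall>x\<in>X. target_block E P x \<in> feasible_target_block E p_lo p_up x}"

definition feasible_sources ::
  "'b set \<Rightarrow> ('a \<times> 'b) set \<Rightarrow> ('b \<Rightarrow> real) \<Rightarrow> ('b \<Rightarrow> real) \<Rightarrow> ('a \<times> 'b \<Rightarrow> real) set" where
  "feasible_sources Y E q_lo q_up =
    {P \<in> E \<rightarrow>\<^sub>E UNIV. \<forall>y\<in>Y. source_block E P y \<in> feasible_source_block E q_lo q_up y}"

definition objective ::
  "'a set \<Rightarrow> 'b set \<Rightarrow> ('a \<times> 'b) set \<Rightarrow> 'a set \<Rightarrow> ('a \<times> 'b \<Rightarrow> real) \<Rightarrow> ('a \<times> 'b \<Rightarrow> real) \<Rightarrow>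
   ('a \<times> 'b \<Rightarrow> real) \<Rightarrow> ('a \<times> 'b \<Rightarrow> real) \<Rightarrow> ('a \<times> 'b \<Rightarrow> real) \<Rightarrow> real" where
  "objective X Y E Xa \<delta> \<gamma> \<xi> Pt Ps =
    - (\<Sum>x\<in>X - Xa. \<Sum>y\<in>sources_of E x. \<delta> (x, y) * Pt (x, y))
    - (\<Sum>y\<in>Y. \<Sum>x\<in>targets_of E y. \<gamma> (x, y) * Ps (x, y))
    - (\<Sum>x\<in>Xa. \<Sum>y\<in>sources_of E x. (\<delta> (x, y) + \<xi> (x, y)) * Pt (x, y))"

definition augmented_lagrangian ::
  "'a set \<Rightarrow> 'b set \<Rightarrow> ('a \<times> 'b) set \<Rightarrow> 'a set \<Rightarrow> ('a \<times> 'b \<Rightarrow> real) \<Rightarrow> ('a \<times> 'b \<Rightarrow> real) \<Rightarrow>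
   ('a \<times> 'b \<Rightarrow> real) \<Rightarrow> real \<Rightarrow> ('a \<times> 'b \<Rightarrow> real) \<Rightarrow> ('a \<times> 'b \<Rightarrow> real) \<Rightarrow> ('a \<times> 'b \<Rightarrow> real) \<Rightarrow>
   ('a \<times> 'b \<Rightarrow> real) \<Rightarrow> ('a \<times> 'b \<Rightarrow> real) \<Rightarrow> real" where
  "augmented_lagrangian X Y E Xa \<delta> \<gamma> \<xi> \<eta> Pt Ps P \<alpha>t \<alpha>s =
    objective X Y E Xa \<delta> \<gamma> \<xi> Pt Ps +
    (\<Sum>e\<in>E. \<alpha>t e * (Pt e - P e) + \<alpha>s e * (P e - Ps e)
      + \<eta> / 2 * (Pt e - P e)\<^sup>2 + \<eta> / 2 * (P e - Ps e)\<^sup>2)"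

text \<open>
  One iteration from \<open>(P, \<alpha>t, \<alpha>s)\<close> to \<open>(Pt', Ps', P', \<alpha>t', \<alpha>s')\<close>.  Minimizers need not be
  unique a priori, so this is a relation rather than a function.
\<close>

definition admm_iteration ::
  "'a set \<Rightarrow> 'b set \<Rightarrow> ('a \<times> 'b) set \<Rightarrow> 'a set \<Rightarrow> ('a \<times> 'b \<Rightarrow> real) \<Rightarrow> ('a \<times> 'b \<Rightarrow> real) \<Rightarrow>
   ('a \<Rightarrow> real) \<Rightarrow> ('a \<Rightarrow> real) \<Rightarrow> ('b \<Rightarrow> real) \<Rightarrow> ('b \<Rightarrow> real) \<Rightarrow> ('a \<times> 'b \<Rightarrow> real) \<Rightarrow> real \<Rightarrow>
   ('a \<times> 'b \<Rightarrow> real) \<Rightarrow> ('a \<times> 'b \<Rightarrow> real) \<Rightarrow> ('a \<times> 'b \<Rightarrow> real) \<Rightarrow>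
   ('a \<times> 'b \<Rightarrow> real) \<Rightarrow> ('a \<times> 'b \<Rightarrow> real) \<Rightarrow> ('a \<times> 'b \<Rightarrow> real) \<Rightarrow>
   ('a \<times> 'b \<Rightarrow> real) \<Rightarrow> ('a \<times> 'b \<Rightarrow> real) \<Rightarrow> bool" where
  "admm_iteration X Y E Xa \<delta> \<gamma> p_lo p_up q_lo q_up \<xi> \<eta> P \<alpha>t \<alpha>s Pt' Ps' P' \<alpha>t' \<alpha>s' \<longleftrightarrow>
    is_arg_min (\<lambda>(Qt, Qs). augmented_lagrangian X Y E Xa \<delta> \<gamma> \<xi> \<eta> Qt Qs P \<alpha>t \<alpha>s)
      (\<lambda>(Qt, Qs). Qt \<in> feasible_targets X E p_lo p_up \<and> Qs \<in> feasible_sources Y E q_lo q_up)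
      (Pt', Ps') \<and>
    is_arg_min (\<lambda>Q. augmented_lagrangian X Y E Xa \<delta> \<gamma> \<xi> \<eta> Pt' Ps' Q \<alpha>t \<alpha>s)
      (\<lambda>Q. Q \<in> E \<rightarrow>\<^sub>E UNIV) P' \<and>
    (\<forall>e\<in>E. \<alpha>t' e = \<alpha>t e + \<eta> * (Pt' e - P' e)) \<and>
    (\<forall>e\<in>E. \<alpha>s' e = \<alpha>s e + \<eta> * (P' e - Ps' e))"

end

theory Submission
  imports Defs
begin

text \<open>
  At fixed \<open>\<Pi>(k)\<close> and multipliers, the augmented Lagrangian is, up to a constant, a sum of one
  function per target block of \<open>\<Pi>\<^sup>t\<close> and one function per source block of \<open>\<Pi>\<^sup>s\<close>, and the feasible set
  is the product of the block constraints; at fixed \<open>(\<Pi>\<^sup>t, \<Pi>\<^sup>s)\<close> it is a sum over edges.  A point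
  minimizes such a separable function over a product set iff each block is a minimizer: replacing
  a single block of a minimizer leaves the other summands unchanged.
\<close>

section \<open>Minimizers of separable functions\<close>

text \<open>Against a competitor that differs from \<open>(a, b)\<close> in one coordinate only, the
  other summand and \<open>c\<close> cancel; conversely the two separate inequalities add
  up.\<close>

lemma is_arg_min_add_pair:
  fixes f :: "'p \<Rightarrow> real" and g :: "'q \<Rightarrow> real"
  assumes J: "\<And>u v. J (u, v) = f u + g v + c"
  shows "is_arg_min J (\<lambda>(u, v). A u \<and> B v) (a, b) \<longleftrightarrow> is_arg_min f A a \<and> is_arg_min g B b"
proof
  assume min: "is_arg_min J (\<lambda>(u, v). A u \<and> B v) (a, b)"
  then have ab: "A a" "B b"
    by (auto simp: is_arg_min_linorder)
  have le: "J (a, b) \<le> J (u, v)" if "A u" "B v" for u v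
    using min that by (auto simp: is_arg_min_linorder)
  show "is_arg_min f A a \<and> is_arg_min g B b"
    using ab le[OF _ ab(2)] le[OF ab(1)] by (simp add: is_arg_min_linorder J)
next
  assume "is_arg_min f A a \<and> is_arg_min g B b"
  then show "is_arg_min J (\<lambda>(u, v). A u \<and> B v) (a, b)"
    by (auto simp: is_arg_min_linorder J intro!: add_mono)
qed

text \<open>The block map \<open>b\<close> is kept abstract so that target blocks, source blocks and
  single edges are all instances. The product structure enters only through \<open>replace\<close>:
  inside the ambient set \<open>D\<close>, one block of \<open>P\<close> can be exchanged for any
  element of \<open>C i\<close> while the others stay.\<close>

lemma is_arg_min_sum_blocks:
  fixes f :: "'i \<Rightarrow> 'u \<Rightarrow> real"
  assumes fin: "finite I" and P: "P \<in> D"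
    and F: "\<And>Q. F Q \<longleftrightarrow> Q \<in> D \<and> (\<forall>i\<in>I. b i Q \<in> C i)"
    and J: "\<And>Q. J Q = (\<Sum>i\<in>I. f i (b i Q)) + c"
    and replace: "\<And>i u. i \<in> I \<Longrightarrow> u \<in> C i \<Longrightarrow>
      \<exists>Q\<in>D. b i Q = u \<and> (\<forall>j\<in>I - {i}. b j Q = b j P)"
  shows "is_arg_min J F P \<longleftrightarrow> (\<forall>i\<in>I. is_arg_min (f i) (\<lambda>u. u \<in> C i) (b i P))"
proof
  assume min: "is_arg_min J F P"
  show "\<forall>i\<in>I. is_arg_min (f i) (\<lambda>u. u \<in> C i) (b i P)"
    unfolding is_arg_min_linorder
  proof (intro ballI conjI allI impI)
    fix i assume "i \<in> I"
    then show "b i P \<in> C i"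
      using min by (auto simp: is_arg_min_linorder F)
  next
    fix i u assume i: "i \<in> I" and u: "u \<in> C i"
    from replace[OF i u] obtain Q where Q: "Q \<in> D" "b i Q = u" "\<And>j. j \<in> I - {i} \<Longrightarrow> b j Q = b j P"
      by blast
    have "F Q"
      unfolding F
    proof (intro conjI ballI)
      fix j assume "j \<in> I"
      then show "b j Q \<in> C j"
        using Q u min by (cases "j = i") (auto simp: is_arg_min_linorder F)
    qed (fact Q)
    then have "J P \<le> J Q"
      using min by (auto simp: is_arg_min_linorder)
    \<comment> \<open>Only block \<open>i\<close> changes between \<open>P\<close> and
      \<open>Q\<close>, so once this common part is cancelled, \<open>J P \<le> J Q\<close> compares
      the \<open>i\<close>-th summands alone.\<close>
    moreover have "(\<Sum>j\<in>I - {i}. f j (b j Q)) = (\<Sum>j\<in>I - {i}. f j (b j P))"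
      using Q(3) by (intro sum.cong) auto
    ultimately show "f i (b i P) \<le> f i u"
      using Q(2) by (simp add: J sum.remove[OF fin i])
  qed
next
  assume "\<forall>i\<in>I. is_arg_min (f i) (\<lambda>u. u \<in> C i) (b i P)"
  then show "is_arg_min J F P"
    using P by (auto simp: is_arg_min_linorder F J intro!: sum_mono)
qed

section \<open>Grouping edges by endpoint and replacing a block\<close>

lemma sum_edges_by_target:
  fixes g :: "'a \<times> 'b \<Rightarrow> real"
  assumes "finite X" "finite Y" "E \<subseteq> X \<times> Y"
  shows "(\<Sum>e\<in>E. g e) = (\<Sum>x\<in>X. \<Sum>y\<in>sources_of E x. g (x, y))"
proof -
  have "E = Sigma X (sources_of E)"
    using assms by (auto simp: sources_of_def)
  moreover have "finite (sources_of E x)" for x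
    using assms by (auto intro: finite_subset[of _ Y] simp: sources_of_def)
  ultimately show ?thesis
    using assms(1) by (simp add: sum.Sigma)
qed

text \<open>Reversing all edges exchanges the two sides of the graph, so grouping by target applies
  to \<open>E\<inverse>\<close>.\<close>

lemma sum_edges_by_source:
  fixes g :: "'a \<times> 'b \<Rightarrow> real"
  assumes "finite X" "finite Y" "E \<subseteq> X \<times> Y"
  shows "(\<Sum>e\<in>E. g e) = (\<Sum>y\<in>Y. \<Sum>x\<in>targets_of E y. g (x, y))"
proof -
  have "(\<Sum>e\<in>E. g e) = (\<Sum>e\<in>E\<inverse>. g (prod.swap e))"
    by (rule sum.reindex_bij_witness[of _ prod.swap prod.swap]) auto
  also have "\<dots> = (\<Sum>y\<in>Y. \<Sum>x\<in>sources_of (E\<inverse>) y. g (x, y))"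
    using assms by (subst sum_edges_by_target[of Y X]) auto
  finally show ?thesis
    by (simp add: sources_of_def targets_of_def)
qed

text \<open>Blocks of distinct targets use disjoint sets of edges, so overwriting the edges at
  \<open>x\<close> by \<open>u\<close> does not touch any other block.\<close>

lemma target_block_replace:
  assumes "u \<in> sources_of E x \<rightarrow>\<^sub>E UNIV"
  shows "\<exists>Q\<in>E \<rightarrow>\<^sub>E UNIV. target_block E Q x = u \<and>
    (\<forall>x'\<in>X - {x}. target_block E Q x' = target_block E P x')"
proof (intro bexI conjI ballI)
  let ?Q = "\<lambda>e\<in>E. if fst e = x then u (snd e) else P e"
  \<comment> \<open>Outside \<open>sources_of E x\<close> the block is \<open>undefined\<close> by
    restriction, and \<open>u\<close> agrees there because it is extensional.\<close>
  show "target_block E ?Q x = u"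
    using assms by (auto simp: target_block_def sources_of_def fun_eq_iff PiE_def extensional_def)
  show "target_block E ?Q x' = target_block E P x'" if "x' \<in> X - {x}" for x'
    using that by (auto simp: target_block_def sources_of_def fun_eq_iff)
qed auto

lemma source_block_replace:
  assumes "v \<in> targets_of E y \<rightarrow>\<^sub>E UNIV"
  shows "\<exists>Q\<in>E \<rightarrow>\<^sub>E UNIV. source_block E Q y = v \<and>
    (\<forall>y'\<in>Y - {y}. source_block E Q y' = source_block E P y')"
proof (intro bexI conjI ballI)
  let ?Q = "\<lambda>e\<in>E. if snd e = y then v (fst e) else P e"
  show "source_block E ?Q y = v"
    using assms by (auto simp: source_block_def targets_of_def fun_eq_iff PiE_def extensional_def)
  show "source_block E ?Q y' = source_block E P y'" if "y' \<in> Y - {y}" for y'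
    using that by (auto simp: source_block_def targets_of_def fun_eq_iff)
qed auto

section \<open>Costs of the subproblems and splittings of the augmented Lagrangian\<close>

text \<open>The coefficient \<open>d\<close> is a parameter so that one cost serves all targets:
  \<open>\<delta>\<close> for uncompromised ones, \<open>\<delta> + \<xi>\<close> for compromised
  ones.\<close>

definition target_cost ::
  "('a \<times> 'b) set \<Rightarrow> ('a \<times> 'b \<Rightarrow> real) \<Rightarrow> real \<Rightarrow> ('a \<times> 'b \<Rightarrow> real) \<Rightarrow> ('a \<times> 'b \<Rightarrow> real) \<Rightarrow>
   'a \<Rightarrow> ('b \<Rightarrow> real) \<Rightarrow> real" where
  "target_cost E d \<eta> P \<alpha>t x u =
    - (\<Sum>y\<in>sources_of E x. d (x, y) * u y) + (\<Sum>y\<in>sources_of E x. \<alpha>t (x, y) * u y)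
    + \<eta> / 2 * (\<Sum>y\<in>sources_of E x. (u y - P (x, y))\<^sup>2)"

definition source_cost ::
  "('a \<times> 'b) set \<Rightarrow> ('a \<times> 'b \<Rightarrow> real) \<Rightarrow> real \<Rightarrow> ('a \<times> 'b \<Rightarrow> real) \<Rightarrow> ('a \<times> 'b \<Rightarrow> real) \<Rightarrow>
   'b \<Rightarrow> ('a \<Rightarrow> real) \<Rightarrow> real" where
  "source_cost E \<gamma> \<eta> P \<alpha>s y v =
    - (\<Sum>x\<in>targets_of E y. \<gamma> (x, y) * v x) - (\<Sum>x\<in>targets_of E y. \<alpha>s (x, y) * v x)
    + \<eta> / 2 * (\<Sum>x\<in>targets_of E y. (P (x, y) - v x)\<^sup>2)"

definition edge_cost ::
  "real \<Rightarrow> ('a \<times> 'b \<Rightarrow> real) \<Rightarrow> ('a \<times> 'b \<Rightarrow> real) \<Rightarrow> ('a \<times> 'b \<Rightarrow> real) \<Rightarrow> ('a \<times> 'b \<Rightarrow> real) \<Rightarrow>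
   'a \<times> 'b \<Rightarrow> real \<Rightarrow> real" where
  "edge_cost \<eta> Pt Ps \<alpha>t \<alpha>s e p =
    - \<alpha>t e * p + \<alpha>s e * p + \<eta> / 2 * (Pt e - p)\<^sup>2 + \<eta> / 2 * (p - Ps e)\<^sup>2"

lemma target_cost_cong:
  "(\<And>y. d (x, y) = d' (x, y)) \<Longrightarrow> target_cost E d \<eta> P \<alpha>t x = target_cost E d' \<eta> P \<alpha>t x"
  by (simp add: target_cost_def fun_eq_iff)

text \<open>Turning block costs into sums over \<open>E\<close> gives all terms of the Lagrangian a
  common index set, where they can be compared edge by edge.\<close>

lemma sum_target_cost:
  assumes "finite X" "finite Y" "E \<subseteq> X \<times> Y"
  shows "(\<Sum>x\<in>X. target_cost E d \<eta> P \<alpha>t x (target_block E Q x)) =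
    (\<Sum>e\<in>E. - d e * Q e + \<alpha>t e * Q e + \<eta> / 2 * (Q e - P e)\<^sup>2)"
  unfolding sum_edges_by_target[OF assms]
  by (intro sum.cong refl)
    (simp add: target_cost_def target_block_def sum.distrib sum_subtractf sum_negf sum_distrib_left)

lemma sum_source_cost:
  assumes "finite X" "finite Y" "E \<subseteq> X \<times> Y"
  shows "(\<Sum>y\<in>Y. source_cost E \<gamma> \<eta> P \<alpha>s y (source_block E Q y)) =
    (\<Sum>e\<in>E. - \<gamma> e * Q e - \<alpha>s e * Q e + \<eta> / 2 * (P e - Q e)\<^sup>2)"
  unfolding sum_edges_by_source[OF assms]
  by (intro sum.cong refl)
    (simp add: source_cost_def source_block_def sum.distrib sum_subtractf sum_negf sum_distrib_left)

text \<open>A coefficient that depends on whether the target lies in \<open>Xa\<close> merges the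
  sums over \<open>X - Xa\<close> and \<open>Xa\<close>.\<close>

lemma objective_as_edge_sum:
  assumes "finite X" "finite Y" "E \<subseteq> X \<times> Y" "Xa \<subseteq> X"
  shows "objective X Y E Xa \<delta> \<gamma> \<xi> Pt Ps =
    (\<Sum>e\<in>E. - (if fst e \<in> Xa then \<delta> e + \<xi> e else \<delta> e) * Pt e - \<gamma> e * Ps e)"
proof -
  let ?d = "\<lambda>e. if fst e \<in> Xa then \<delta> e + \<xi> e else \<delta> e"
  have "(\<Sum>e\<in>E. ?d e * Pt e) =
      (\<Sum>x\<in>X - Xa. \<Sum>y\<in>sources_of E x. ?d (x, y) * Pt (x, y)) +
      (\<Sum>x\<in>Xa. \<Sum>y\<in>sources_of E x. ?d (x, y) * Pt (x, y))"
    unfolding sum_edges_by_target[OF assms(1-3)]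
    by (rule sum.subset_diff[OF assms(4,1)])
  also have "\<dots> = (\<Sum>x\<in>X - Xa. \<Sum>y\<in>sources_of E x. \<delta> (x, y) * Pt (x, y)) +
      (\<Sum>x\<in>Xa. \<Sum>y\<in>sources_of E x. (\<delta> (x, y) + \<xi> (x, y)) * Pt (x, y))"
    by (intro arg_cong2[where f = "(+)"] sum.cong) auto
  finally show ?thesis
    using sum_edges_by_source[OF assms(1-3), of "\<lambda>e. \<gamma> e * Ps e"]
    by (simp add: objective_def sum_subtractf sum_negf)
qed

text \<open>Each penalty term contains only one of \<open>Pt\<close> and \<open>Ps\<close>, and
  expanding the multiplier terms separates them as well. The last sum is what remains: it depends on
  \<open>P\<close> and the multipliers only, hence is constant in the first minimization.\<close>

lemma augmented_lagrangian_by_blocks: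
  assumes "finite X" "finite Y" "E \<subseteq> X \<times> Y" "Xa \<subseteq> X"
  shows "augmented_lagrangian X Y E Xa \<delta> \<gamma> \<xi> \<eta> Pt Ps P \<alpha>t \<alpha>s =
    (\<Sum>x\<in>X. target_cost E (\<lambda>e. if fst e \<in> Xa then \<delta> e + \<xi> e else \<delta> e) \<eta> P \<alpha>t x (target_block E Pt x)) +
    (\<Sum>y\<in>Y. source_cost E \<gamma> \<eta> P \<alpha>s y (source_block E Ps y)) +
    (\<Sum>e\<in>E. \<alpha>s e * P e - \<alpha>t e * P e)"
  unfolding augmented_lagrangian_def objective_as_edge_sum[OF assms] sum_target_cost[OF assms(1-3)]
    sum_source_cost[OF assms(1-3)] sum.distrib[symmetric]
  by (rule sum.cong) (auto simp: algebra_simps)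

text \<open>Here \<open>P\<close> varies instead, so the objective and the products of multipliers
  with \<open>Pt\<close> and \<open>Ps\<close> form the constant.\<close>

lemma augmented_lagrangian_by_edges:
  "augmented_lagrangian X Y E Xa \<delta> \<gamma> \<xi> \<eta> Pt Ps P \<alpha>t \<alpha>s =
    (\<Sum>e\<in>E. edge_cost \<eta> Pt Ps \<alpha>t \<alpha>s e (P e)) +
    (objective X Y E Xa \<delta> \<gamma> \<xi> Pt Ps + (\<Sum>e\<in>E. \<alpha>t e * Pt e - \<alpha>s e * Ps e))"
proof -
  have "(\<Sum>e\<in>E. \<alpha>t e * (Pt e - P e) + \<alpha>s e * (P e - Ps e)
      + \<eta> / 2 * (Pt e - P e)\<^sup>2 + \<eta> / 2 * (P e - Ps e)\<^sup>2) =
      (\<Sum>e\<in>E. edge_cost \<eta> Pt Ps \<alpha>t \<alpha>s e (P e)) + (\<Sum>e\<in>E. \<alpha>t e * Pt e - \<alpha>s e * Ps e)"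
    unfolding sum.distrib[symmetric]
    by (rule sum.cong) (auto simp: edge_cost_def algebra_simps)
  then show ?thesis
    by (simp add: augmented_lagrangian_def)
qed

section \<open>Decoupling of the minimization steps\<close>

text \<open>The assumption on \<open>Pt'\<close> places it in the ambient space only; its
  feasibility is part of being a minimizer on either side.\<close>

lemma is_arg_min_targets:
  assumes "finite X" "Pt' \<in> E \<rightarrow>\<^sub>E UNIV"
  shows "is_arg_min (\<lambda>Q. \<Sum>x\<in>X. target_cost E d \<eta> P \<alpha>t x (target_block E Q x))
      (\<lambda>Q. Q \<in> feasible_targets X E p_lo p_up) Pt' \<longleftrightarrow>
    (\<forall>x\<in>X. is_arg_min (target_cost E d \<eta> P \<alpha>t x)
      (\<lambda>u. u \<in> feasible_target_block E p_lo p_up x) (target_block E Pt' x))"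
  by (rule is_arg_min_sum_blocks[where c = 0 and b = "\<lambda>x Q. target_block E Q x", OF assms])
    (auto simp: feasible_targets_def feasible_target_block_def intro!: target_block_replace)

lemma is_arg_min_sources:
  assumes "finite Y" "Ps' \<in> E \<rightarrow>\<^sub>E UNIV"
  shows "is_arg_min (\<lambda>Q. \<Sum>y\<in>Y. source_cost E \<gamma> \<eta> P \<alpha>s y (source_block E Q y))
      (\<lambda>Q. Q \<in> feasible_sources Y E q_lo q_up) Ps' \<longleftrightarrow>
    (\<forall>y\<in>Y. is_arg_min (source_cost E \<gamma> \<eta> P \<alpha>s y)
      (\<lambda>v. v \<in> feasible_source_block E q_lo q_up y) (source_block E Ps' y))"
  by (rule is_arg_min_sum_blocks[where c = 0 and b = "\<lambda>y Q. source_block E Q y", OF assms])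
    (auto simp: feasible_sources_def feasible_source_block_def intro!: source_block_replace)

text \<open>Every edge is a block of its own with constraint set \<open>UNIV\<close>, since the
  second minimization is unconstrained.\<close>

lemma is_arg_min_edges:
  assumes "finite E" "P' \<in> E \<rightarrow>\<^sub>E UNIV"
  shows "is_arg_min (\<lambda>Q. augmented_lagrangian X Y E Xa \<delta> \<gamma> \<xi> \<eta> Pt Ps Q \<alpha>t \<alpha>s)
      (\<lambda>Q. Q \<in> E \<rightarrow>\<^sub>E UNIV) P' \<longleftrightarrow>
    (\<forall>e\<in>E. is_arg_min (edge_cost \<eta> Pt Ps \<alpha>t \<alpha>s e) (\<lambda>p. p \<in> UNIV) (P' e))"
proof (rule is_arg_min_sum_blocks[where b = "\<lambda>e Q. Q e", OF assms _ augmented_lagrangian_by_edges])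
  show "\<exists>Q\<in>E \<rightarrow>\<^sub>E UNIV. Q e = u \<and> (\<forall>e'\<in>E - {e}. Q e' = P' e')" if "e \<in> E" for e u
    \<comment> \<open>As \<open>e\<close> lies in \<open>E\<close>, the update at \<open>e\<close>
      keeps the family \<open>undefined\<close> off \<open>E\<close>.\<close>
    using that assms(2) by (intro bexI[of _ "P'(e := u)"]) (auto simp: PiE_def extensional_def)
qed auto

theorem theorem1:
  fixes X :: "'a set" and Y :: "'b set" and E :: "('a \<times> 'b) set" and Xa :: "'a set"
    and \<delta> \<gamma> \<xi> :: "'a \<times> 'b \<Rightarrow> real"
    and p_lo p_up :: "'a \<Rightarrow> real" and q_lo q_up :: "'b \<Rightarrow> real"
    and \<eta> :: real
    and P \<alpha>t \<alpha>s Pt' Ps' P' \<alpha>t' \<alpha>s' :: "'a \<times> 'b \<Rightarrow> real"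
  assumes "transport_network X Y E Xa \<delta> \<gamma> p_lo p_up q_lo q_up"
    and "\<eta> > 0"
    and "P \<in> E \<rightarrow>\<^sub>E UNIV" and "\<alpha>t \<in> E \<rightarrow>\<^sub>E UNIV" and "\<alpha>s \<in> E \<rightarrow>\<^sub>E UNIV"
    and "Pt' \<in> E \<rightarrow>\<^sub>E UNIV" and "Ps' \<in> E \<rightarrow>\<^sub>E UNIV" and "P' \<in> E \<rightarrow>\<^sub>E UNIV"
    and "\<alpha>t' \<in> E \<rightarrow>\<^sub>E UNIV" and "\<alpha>s' \<in> E \<rightarrow>\<^sub>E UNIV"
  shows "admm_iteration X Y E Xa \<delta> \<gamma> p_lo p_up q_lo q_up \<xi> \<eta> P \<alpha>t \<alpha>s Pt' Ps' P' \<alpha>t' \<alpha>s' \<longleftrightarrow>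
    (\<forall>x\<in>X - Xa. is_arg_min
       (\<lambda>u. - (\<Sum>y\<in>sources_of E x. \<delta> (x, y) * u y)
            + (\<Sum>y\<in>sources_of E x. \<alpha>t (x, y) * u y)
            + \<eta> / 2 * (\<Sum>y\<in>sources_of E x. (u y - P (x, y))\<^sup>2))
       (\<lambda>u. u \<in> feasible_target_block E p_lo p_up x) (target_block E Pt' x)) \<and>
    (\<forall>x\<in>Xa. is_arg_min
       (\<lambda>u. - (\<Sum>y\<in>sources_of E x. (\<delta> (x, y) + \<xi> (x, y)) * u y)
            + (\<Sum>y\<in>sources_of E x. \<alpha>t (x, y) * u y)
            + \<eta> / 2 * (\<Sum>y\<in>sources_of E x. (u y - P (x, y))\<^sup>2))
       (\<lambda>u. u \<in> feasible_target_block E p_lo p_up x) (target_block E Pt' x)) \<and>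
    (\<forall>y\<in>Y. is_arg_min
       (\<lambda>v. - (\<Sum>x\<in>targets_of E y. \<gamma> (x, y) * v x)
            - (\<Sum>x\<in>targets_of E y. \<alpha>s (x, y) * v x)
            + \<eta> / 2 * (\<Sum>x\<in>targets_of E y. (P (x, y) - v x)\<^sup>2))
       (\<lambda>v. v \<in> feasible_source_block E q_lo q_up y) (source_block E Ps' y)) \<and>
    (\<forall>e\<in>E. is_arg_min
       (\<lambda>p::real. - \<alpha>t e * p + \<alpha>s e * p
            + \<eta> / 2 * (Pt' e - p)\<^sup>2 + \<eta> / 2 * (p - Ps' e)\<^sup>2)
       (\<lambda>p. p \<in> UNIV) (P' e)) \<and>
    (\<forall>e\<in>E. \<alpha>t' e = \<alpha>t e + \<eta> * (Pt' e - P' e)) \<and>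
    (\<forall>e\<in>E. \<alpha>s' e = \<alpha>s e + \<eta> * (P' e - Ps' e))"
proof -
  interpret transport_network X Y E Xa \<delta> \<gamma> p_lo p_up q_lo q_up
    by (fact assms(1))
  let ?d = "\<lambda>e. if fst e \<in> Xa then \<delta> e + \<xi> e else \<delta> e"
  have "finite E"
    using finite_X finite_Y edges by (auto intro: finite_subset)
  note edge_step = is_arg_min_edges[OF this assms(8)]
  \<comment> \<open>The joint minimization splits first into a target and a source problem; the
    offset is the edge sum that involves neither \<open>Qt\<close> nor \<open>Qs\<close>.\<close>
  have "is_arg_min (\<lambda>(Qt, Qs). augmented_lagrangian X Y E Xa \<delta> \<gamma> \<xi> \<eta> Qt Qs P \<alpha>t \<alpha>s)
      (\<lambda>(Qt, Qs). Qt \<in> feasible_targets X E p_lo p_up \<and> Qs \<in> feasible_sources Y E q_lo q_up)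
      (Pt', Ps') \<longleftrightarrow>
    is_arg_min (\<lambda>Q. \<Sum>x\<in>X. target_cost E ?d \<eta> P \<alpha>t x (target_block E Q x))
      (\<lambda>Q. Q \<in> feasible_targets X E p_lo p_up) Pt' \<and>
    is_arg_min (\<lambda>Q. \<Sum>y\<in>Y. source_cost E \<gamma> \<eta> P \<alpha>s y (source_block E Q y))
      (\<lambda>Q. Q \<in> feasible_sources Y E q_lo q_up) Ps'"
    by (rule is_arg_min_add_pair)
      (simp add: augmented_lagrangian_by_blocks[OF finite_X finite_Y edges compromised])
  then have block_step: "is_arg_min (\<lambda>(Qt, Qs). augmented_lagrangian X Y E Xa \<delta> \<gamma> \<xi> \<eta> Qt Qs P \<alpha>t \<alpha>s)
      (\<lambda>(Qt, Qs). Qt \<in> feasible_targets X E p_lo p_up \<and> Qs \<in> feasible_sources Y E q_lo q_up)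
      (Pt', Ps') \<longleftrightarrow>
    (\<forall>x\<in>X. is_arg_min (target_cost E ?d \<eta> P \<alpha>t x)
      (\<lambda>u. u \<in> feasible_target_block E p_lo p_up x) (target_block E Pt' x)) \<and>
    (\<forall>y\<in>Y. is_arg_min (source_cost E \<gamma> \<eta> P \<alpha>s y)
      (\<lambda>v. v \<in> feasible_source_block E q_lo q_up y) (source_block E Ps' y))"
    by (simp only: is_arg_min_targets[OF finite_X assms(6)] is_arg_min_sources[OF finite_Y assms(7)])
  have uncompromised_cost: "target_cost E ?d \<eta> P \<alpha>t x = target_cost E \<delta> \<eta> P \<alpha>t x" if "x \<in> X - Xa" for x
    using that by (intro target_cost_cong) simp
  have compromised_cost: "target_cost E ?d \<eta> P \<alpha>t x = target_cost E (\<lambda>e. \<delta> e + \<xi> e) \<eta> P \<alpha>t x"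
    if "x \<in> Xa" for x
    using that by (intro target_cost_cong) simp
  \<comment> \<open>Because \<open>Xa \<subseteq> X\<close>, the targets split into
    \<open>X - Xa\<close> and \<open>Xa\<close>, and on each part \<open>?d\<close> collapses to a
    single formula.\<close>
  have "(\<forall>x\<in>X. is_arg_min (target_cost E ?d \<eta> P \<alpha>t x)
      (\<lambda>u. u \<in> feasible_target_block E p_lo p_up x) (target_block E Pt' x)) \<longleftrightarrow>
    (\<forall>x\<in>X - Xa. is_arg_min (target_cost E \<delta> \<eta> P \<alpha>t x)
      (\<lambda>u. u \<in> feasible_target_block E p_lo p_up x) (target_block E Pt' x)) \<and>
    (\<forall>x\<in>Xa. is_arg_min (target_cost E (\<lambda>e. \<delta> e + \<xi> e) \<eta> P \<alpha>t x)
      (\<lambda>u. u \<in> feasible_target_block E p_lo p_up x) (target_block E Pt' x))"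
    (is "(\<forall>x\<in>X. ?min x) \<longleftrightarrow> ?rhs")
  proof -
    have "(\<forall>x\<in>X. ?min x) \<longleftrightarrow> (\<forall>x\<in>X - Xa. ?min x) \<and> (\<forall>x\<in>Xa. ?min x)"
      using compromised by blast
    also have "\<dots> \<longleftrightarrow> ?rhs"
      by (simp only: uncompromised_cost compromised_cost cong: ball_cong)
    finally show ?thesis .
  qed
  then show ?thesis
    \<comment> \<open>The multiplier updates are the same conjuncts on both sides, so unfolding the
      costs and reassociating suffices.\<close>
    unfolding admm_iteration_def block_step edge_step
    by (simp only: target_cost_def[abs_def] source_cost_def[abs_def] edge_cost_def[abs_def] conj_assoc)
qed

end
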